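(* Let $G$ be a finite simple graph that is hole-free, paraglider-free and has no clique separator, and suppose $G$ contains an induced subgraph $A$ isomorphic to $\overline{C_6}$. Let $A_6$ be the set of vertices outside $V(A)$ that are adjacent to all vertices of $A$. Then $G\setminus A_6$ (the subgraph induced by $V(G)\setminus A_6$) is a matched co-bipartite graph.
   Context: A hole is an induced chordless cycle with at least five vertices. A paraglider is the graph on five vertices $u_1,u_2,w_1,w_2,p$ with edges $u_1u_2$, $u_iw_j$ for $i,j\in\{1,2\}$, $pw_1$, $pw_2$ (the complement of $P_2\cup P_3$). A graph is $H$-free if it has no induced subgraph isomorphic to $H$. A clique separator of $G$ is a clique $K$ such that $G[V\setminus K]$ has more connected components than $G$; an atom is a graph without clique separator. A matched co-bipartite graph consists of two disjoint cliques of the same size $k$ where the edges between the two cliques form a perfect matching. $\overline{C_6}$ is the complement of the chordless 6-cycle.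
   Formalization: G is additionally assumed connected: with clique separators defined by an increase in the number of components, the claim fails for the disjoint union of the complement of C_6 and an isolated vertex, and its conclusion fails for every disconnected G. *)

theory Defs
  imports "Graph_Theory.Graph_Theory"
begin

text \<open>
  A finite simple graph is a symmetric, loop-free digraph without parallel arcs, i.e. an
  instance of the locale \<^locale>\<open>graph\<close>; \<open>u \<rightarrow>\<^bsub>G\<^esub> v\<close> is adjacency.  Concrete graphs are given as
  pair digraphs, whose arcs are ordered pairs of vertices.
\<close>

definition cycle_graph :: "nat \<Rightarrow> nat pair_pre_digraph" where
  "cycle_graph n = \<lparr> pverts = {..<n},
     parcs = (let E = {(i, (i + 1) mod n) | i. i < n} in E \<union> E\<inverse>) \<rparr>"

definition complement_graph :: "'a pair_pre_digraph \<Rightarrow> 'a pair_pre_digraph" where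
  "complement_graph H = \<lparr> pverts = pverts H,
     parcs = {(u, v) \<in> pverts H \<times> pverts H. u \<noteq> v \<and> (u, v) \<notin> parcs H} \<rparr>"

definition co_C6 :: "nat pair_pre_digraph" where
  "co_C6 = complement_graph (cycle_graph 6)"

datatype paraglider_vertex = U1 | U2 | W1 | W2 | P

definition paraglider :: "paraglider_vertex pair_pre_digraph" where
  "paraglider = \<lparr> pverts = {U1, U2, W1, W2, P},
     parcs = (let E = {(U1, U2), (U1, W1), (U1, W2), (U2, W1), (U2, W2), (P, W1), (P, W2)}
              in E \<union> E\<inverse>) \<rparr>"

text \<open>
  The predicate \<^const>\<open>digraph_iso\<close> requires its first argument to be well-formed, and symmetry
  of the relation relies on this, so we check that the concrete graphs are graphs.
\<close>

lemma pair_graph_cycle_graph: "3 \<le> n \<Longrightarrow> pair_graph (cycle_graph n)"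
  apply unfold_locales
  by (auto simp: cycle_graph_def Let_def symmetric_def sym_def mod_Suc split: if_splits)

lemma pair_graph_complement_graph:
  "pair_graph H \<Longrightarrow> pair_graph (complement_graph H)"
proof -
  assume "pair_graph H"
  then interpret H: pair_graph H .
  have "finite (parcs (complement_graph H))"
    by (rule finite_subset[of _ "pverts H \<times> pverts H"])
      (auto simp: complement_graph_def H.pair_finite_verts)
  moreover have "sym (parcs H)"
    using H.pair_sym_arcs by (simp add: symmetric_def)
  ultimately show ?thesis
    by unfold_locales
      (auto simp: complement_graph_def symmetric_def sym_def H.pair_finite_verts)
qed

lemma pair_graph_co_C6: "pair_graph co_C6"
  unfolding co_C6_def by (intro pair_graph_complement_graph pair_graph_cycle_graph) simp

lemma pair_graph_paraglider: "pair_graph paraglider"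
  by unfold_locales (auto simp: paraglider_def Let_def symmetric_def sym_def)

definition hole :: "('a, 'b) pre_digraph \<Rightarrow> ('a, 'b) pre_digraph \<Rightarrow> bool" where
  "hole C G \<longleftrightarrow> induced_subgraph C G \<and> (\<exists>n\<ge>5. digraph_iso C (cycle_graph n))"

definition hole_free :: "('a, 'b) pre_digraph \<Rightarrow> bool" where
  "hole_free G \<longleftrightarrow> \<not> (\<exists>C. hole C G)"

definition induced_free :: "('c, 'd) pre_digraph \<Rightarrow> ('a, 'b) pre_digraph \<Rightarrow> bool" where
  "induced_free H G \<longleftrightarrow> \<not> (\<exists>S. induced_subgraph S G \<and> digraph_iso S H)"

definition clique :: "('a, 'b) pre_digraph \<Rightarrow> 'a set \<Rightarrow> bool" where
  "clique G K \<longleftrightarrow> K \<subseteq> verts G \<and> (\<forall>u\<in>K. \<forall>v\<in>K. u \<noteq> v \<longrightarrow> u \<rightarrow>\<^bsub>G\<^esub> v)"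

text \<open>
  In a symmetric digraph the connected components are the strongly connected components;
  \<open>sccs_verts\<close> is the collection of their vertex sets.  Components are counted relative to
  \<open>G\<close>, so the empty clique never is a separator, not even of a disconnected graph.
\<close>

definition clique_separator :: "('a, 'b) pre_digraph \<Rightarrow> 'a set \<Rightarrow> bool" where
  "clique_separator G K \<longleftrightarrow> clique G K \<and>
     card (pre_digraph.sccs_verts (G \<restriction> (verts G - K))) > card (pre_digraph.sccs_verts G)"

definition matched_co_bipartite :: "('a, 'b) pre_digraph \<Rightarrow> bool" where
  "matched_co_bipartite G \<longleftrightarrow>
     (\<exists>K L. K \<union> L = verts G \<and> K \<inter> L = {} \<and> clique G K \<and> clique G L \<and> card K = card L \<and>
        (\<forall>u\<in>K. \<exists>!v. v \<in> L \<and> u \<rightarrow>\<^bsub>G\<^esub> v) \<and> (\<forall>v\<in>L. \<exists>!u. u \<in> K \<and> u \<rightarrow>\<^bsub>G\<^esub> v))"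

end

theory Submission
  imports Defs
begin

text \<open>
  Extend \<open>A\<close> to a maximal induced matched co-bipartite subgraph \<open>H\<close> with cliques \<open>a\<^sub>0, \<dots>\<close> and
  \<open>b\<^sub>0, \<dots>\<close>, and let \<open>U\<close> be the set of vertices complete to \<open>H\<close>.  Any other vertex attaches to \<open>H\<close>
  in a clique, and \<open>U\<close> is a clique.  Suppose a component of the remaining vertices attaches to \<open>H\<close> in a
  set that is not a clique, and take a shortest path between two vertices of the component with
  nonadjacent neighbours in \<open>H\<close>.  Closing it up through \<open>H\<close> in various ways produces a hole unless
  the path is a single edge whose ends are complete to one side of \<open>H\<close> each, and then \<open>H\<close> was not
  maximal.  So the attachments of the component together with \<open>U\<close> form a clique separator, whence
  there is no such component.
\<close>

unbundle no funcset_syntax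

section \<open>Vertex maps and isomorphisms with concrete graphs\<close>

lemma dominates_induce_iff:
  "u \<rightarrow>\<^bsub>G \<restriction> S\<^esub> v \<longleftrightarrow> u \<in> S \<and> v \<in> S \<and> u \<rightarrow>\<^bsub>G\<^esub> v"
  unfolding arcs_ends_conv by auto

text \<open>Forbidden subgraphs can thus be exhibited by naming vertices: without parallel arcs an
  arc is determined by its ends, so a map that preserves and reflects adjacency carries the arcs
  along.\<close>

lemma (in graph) digraph_iso_induce:
  fixes H :: "'c pair_pre_digraph"
  assumes H: "pair_graph H"
    and inj: "inj_on f (pverts H)" and img: "f ` pverts H \<subseteq> verts G"
    and adj: "\<And>u v. u \<in> pverts H \<Longrightarrow> v \<in> pverts H \<Longrightarrow> f u \<rightarrow> f v \<longleftrightarrow> (u, v) \<in> parcs H"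
  shows "digraph_iso (G \<restriction> f ` pverts H) (with_proj H)"
proof -
  interpret H: pair_graph H by (rule H)
  define g where "g = the_inv_into (pverts H) f"
  have gf [simp]: "g (f u) = u" if "u \<in> pverts H" for u
    using that inj by (simp add: g_def the_inv_into_f_f)
  \<comment> \<open>The isomorphism runs from the subgraph to \<open>H\<close>, hence the inverse
    \<open>g\<close>. An arc goes to the pair of images of its ends, since arcs of a pair digraph
    are such pairs.\<close>
  define iso where "iso = \<lparr> iso_verts = g, iso_arcs = (\<lambda>e. (g (tail G e), g (head G e))),
    iso_head = (snd :: 'c \<times> 'c \<Rightarrow> 'c), iso_tail = (fst :: 'c \<times> 'c \<Rightarrow> 'c) \<rparr>"
  let ?S = "G \<restriction> f ` pverts H"
  have wf: "wf_digraph ?S"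
    by (rule wellformed_induce_subgraph)
  have "inj_on (\<lambda>e. (g (tail G e), g (head G e))) (arcs ?S)"
  proof (rule inj_onI)
    fix e e' assume e: "e \<in> arcs ?S" "e' \<in> arcs ?S"
      and eq: "(g (tail G e), g (head G e)) = (g (tail G e'), g (head G e'))"
    from e eq have "arc_to_ends G e = arc_to_ends G e'"
      by (auto simp: arc_to_ends_def)
    with e show "e = e'" by (auto intro: no_multi_arcs)
  qed
  moreover have "inj_on g (verts ?S)"
    by (auto intro!: inj_onI)
  ultimately have iso: "pre_digraph.digraph_isomorphism ?S iso"
    using wf by (auto simp: pre_digraph.digraph_isomorphism_def iso_def)
  have "(\<lambda>e. (g (tail G e), g (head G e))) ` arcs ?S = parcs H"
  proof (intro equalityI subsetI)
    fix p assume "p \<in> (\<lambda>e. (g (tail G e), g (head G e))) ` arcs ?S"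
    then obtain e u v where e: "e \<in> arcs G" "u \<in> pverts H" "v \<in> pverts H"
        "tail G e = f u" "head G e = f v" "p = (g (tail G e), g (head G e))"
      by auto
    then have "f u \<rightarrow> f v" by (auto simp: arcs_ends_conv intro!: rev_image_eqI[of e])
    with e adj show "p \<in> parcs H" by auto
  next
    fix p assume p: "p \<in> parcs H"
    obtain u v where uv: "p = (u, v)" by (cases p)
    with p have V: "u \<in> pverts H" "v \<in> pverts H"
      using H.pair_wf_digraph by (auto dest: pair_wf_digraph.in_arcsD1 pair_wf_digraph.in_arcsD2)
    with p uv adj have "f u \<rightarrow> f v" by auto
    then obtain e where e: "e \<in> arcs G" "tail G e = f u" "head G e = f v" by auto
    with V show "p \<in> (\<lambda>e. (g (tail G e), g (head G e))) ` arcs ?S"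
      by (auto simp: uv intro!: image_eqI[of _ _ e])
  qed
  moreover have "g ` f ` pverts H = pverts H"
    by (force simp: image_iff)
  ultimately have "with_proj H = app_iso iso ?S"
    by (auto simp: app_iso_def iso_def with_proj_def)
  with iso show ?thesis by (auto simp: digraph_iso_def)
qed

text \<open>The opposite translation, used to name the vertices of \<open>A\<close>. Arcs of
  \<open>with_proj H\<close> are ordered pairs, so the vertex map alone determines the arc
  map.\<close>

lemma digraph_iso_verts_map:
  assumes "digraph_iso A (with_proj H)"
  obtains f where "bij_betw f (pverts H) (verts A)"
    and "\<And>u v. u \<in> pverts H \<Longrightarrow> v \<in> pverts H \<Longrightarrow> f u \<rightarrow>\<^bsub>A\<^esub> f v \<longleftrightarrow> (u, v) \<in> parcs H"
proof -
  obtain iso where iso: "pre_digraph.digraph_isomorphism A iso" and eq: "with_proj H = app_iso iso A"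
    using assms by (auto simp: digraph_iso_def)
  let ?g = "iso_verts iso"
  from iso have wf: "wf_digraph A" and inj: "inj_on ?g (verts A)"
    by (auto simp: pre_digraph.digraph_isomorphism_def)
  interpret A: wf_digraph A by (rule wf)
  have verts: "pverts H = ?g ` verts A" and arcs: "parcs H = iso_arcs iso ` arcs A"
    using arg_cong[OF eq, of verts] arg_cong[OF eq, of arcs] by simp_all
  have "iso_tail iso = fst" "iso_head iso = snd"
    using arg_cong[OF eq, of tail] arg_cong[OF eq, of head] by simp_all
  with iso have "iso_arcs iso e = (?g (tail A e), ?g (head A e))" if "e \<in> arcs A" for e
    using that by (auto simp: pre_digraph.digraph_isomorphism_def prod_eq_iff)
  with arcs have arcs: "parcs H = (\<lambda>e. (?g (tail A e), ?g (head A e))) ` arcs A"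
    by auto
  have adj: "x \<rightarrow>\<^bsub>A\<^esub> y \<longleftrightarrow> (?g x, ?g y) \<in> parcs H" if "x \<in> verts A" "y \<in> verts A" for x y
    using that inj unfolding arcs arcs_ends_conv
    by (auto simp: inj_on_eq_iff)
  let ?f = "the_inv_into (verts A) ?g"
  have "bij_betw ?g (verts A) (pverts H)"
    using inj verts by (simp add: bij_betw_def)
  then have "bij_betw ?f (pverts H) (verts A)" by (rule bij_betw_the_inv_into)
  moreover have "?f u \<rightarrow>\<^bsub>A\<^esub> ?f v \<longleftrightarrow> (u, v) \<in> parcs H" if "u \<in> pverts H" "v \<in> pverts H" for u v
    using that adj inj unfolding verts by (auto simp: the_inv_into_f_f)
  ultimately show thesis by (rule that)
qed

section \<open>Separation and walks\<close>

text \<open>A connected graph has at most one component, so two distinct reachability classes after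
  deleting \<open>K\<close> suffice.\<close>

lemma (in graph) clique_separatorI:
  assumes con: "connected G" and K: "clique G K"
    and u: "u \<in> verts G - K" and v: "v \<in> verts G - K"
    and sep: "\<not> u \<rightarrow>\<^sup>*\<^bsub>G \<restriction> (verts G - K)\<^esub> v"
  shows "clique_separator G K"
proof -
  let ?G = "G \<restriction> (verts G - K)"
  interpret G': wf_digraph ?G by (rule wellformed_induce_subgraph)
  have sym: "y \<rightarrow>\<^sup>*\<^bsub>?G\<^esub> x" if "x \<rightarrow>\<^sup>*\<^bsub>?G\<^esub> y" for x y
  proof (rule symmetric_reachable[OF _ that])
    show "symmetric ?G"
      using sym_arcs by (auto simp: symmetric_def sym_def dominates_induce_iff)
  qed
  have "strongly_connected G"
    using con by (intro symmetric_connected_imp_strongly_connected sym_arcs)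
  then have reach: "x \<rightarrow>\<^sup>* y" if "x \<in> verts G" "y \<in> verts G" for x y
    using that by auto
  have "S = verts G" if S: "S \<in> sccs_verts" for S
  proof -
    obtain x where x: "x \<in> S" using S by (auto simp: sccs_verts_def)
    have sub: "S \<subseteq> verts G"
      using S reachable_in_verts(1) unfolding sccs_verts_def by blast
    moreover have "y \<in> S" if "y \<in> verts G" for y
    proof -
      have "x \<rightarrow>\<^sup>* y" "y \<rightarrow>\<^sup>* x" using reach sub x that by auto
      with S x show ?thesis unfolding sccs_verts_def by blast
    qed
    ultimately show ?thesis by blast
  qed
  then have "sccs_verts \<subseteq> {verts G}" by auto
  then have le: "card sccs_verts \<le> 1"
    using card_mono[of "{verts G}" sccs_verts] by simp
  define C where "C x = {y. x \<rightarrow>\<^sup>*\<^bsub>?G\<^esub> y}" for x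
  have "C x \<in> G'.sccs_verts" if x: "x \<in> verts G - K" for x
  proof -
    have "x \<in> C x" using x by (auto simp: C_def)
    moreover have "y \<rightarrow>\<^sup>*\<^bsub>?G\<^esub> z" if "y \<in> C x" "z \<in> C x" for y z
      using that sym[of x y] G'.reachable_trans[of y x z] by (simp add: C_def)
    moreover have "z \<in> C x" if "y \<in> C x" "y \<rightarrow>\<^sup>*\<^bsub>?G\<^esub> z" for y z
      using that G'.reachable_trans[of x y z] by (simp add: C_def)
    ultimately show ?thesis unfolding G'.sccs_verts_def by blast
  qed
  moreover have "C u \<noteq> C v"
  proof
    assume "C u = C v"
    moreover have "v \<in> C v" using v by (simp add: C_def)
    ultimately show False using sep by (auto simp: C_def)
  qed
  ultimately have two: "card {C u, C v} = 2" "{C u, C v} \<subseteq> G'.sccs_verts"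
    using u v by simp_all
  \<comment> \<open>\<open>card\<close> of an infinite set is 0, so the lower bound 2 needs
    finiteness.\<close>
  have "S \<subseteq> verts ?G" if "S \<in> G'.sccs_verts" for S
    using that G'.reachable_in_verts(1) unfolding G'.sccs_verts_def by blast
  then have "G'.sccs_verts \<subseteq> Pow (verts ?G)" by blast
  then have "finite G'.sccs_verts"
    by (rule finite_subset) simp
  with two have "2 \<le> card G'.sccs_verts"
    by (metis card_mono)
  with le K show ?thesis by (simp add: clique_separator_def)
qed

text \<open>Walks as functions on \<open>nat\<close>, of which only the values up to
  \<open>m\<close> count, make shortcuts and subwalks plain index arithmetic.\<close>

lemma (in wf_digraph) reachable_induce_walk:
  assumes "u \<rightarrow>\<^sup>*\<^bsub>G \<restriction> W\<^esub> v"
  obtains p m where "p 0 = u" "p m = v" "\<And>t. t \<le> m \<Longrightarrow> p t \<in> W" "\<And>t. t < m \<Longrightarrow> p t \<rightarrow> p (Suc t)"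
proof -
  interpret W: wf_digraph "G \<restriction> W" by (rule wellformed_induce_subgraph)
  from assms have "\<exists>p m. p 0 = u \<and> p m = v \<and> (\<forall>t\<le>m. p t \<in> W) \<and> (\<forall>t<m. p t \<rightarrow> p (Suc t))"
  proof (induction rule: W.converse_reachable_induct)
    case base
    then show ?case by (intro exI[of _ "\<lambda>_. v"] exI[of _ 0]) simp
  next
    case (step x y)
    then obtain p m where p: "p 0 = y" "p m = v" "\<forall>t\<le>m. p t \<in> W" "\<forall>t<m. p t \<rightarrow> p (Suc t)"
      by blast
    with step(1) show ?case
      by (intro exI[of _ "case_nat x p"] exI[of _ "Suc m"])
        (auto simp: dominates_induce_iff split: nat.splits)
  qed
  with that show thesis by blast
qed

text \<open>A repeated vertex or a chord would allow a shortcut inside \<open>W\<close> with the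
  same ends.\<close>

lemma shortest_walk_induced:
  assumes W: "\<And>t. t \<le> m \<Longrightarrow> p t \<in> W" and walk: "\<And>t. t < m \<Longrightarrow> p t \<rightarrow>\<^bsub>G\<^esub> p (Suc t)"
    and shortest: "\<And>q n. n < m \<Longrightarrow> (\<And>t. t \<le> n \<Longrightarrow> q t \<in> W) \<Longrightarrow>
      (\<And>t. t < n \<Longrightarrow> q t \<rightarrow>\<^bsub>G\<^esub> q (Suc t)) \<Longrightarrow> q 0 = p 0 \<Longrightarrow> q n = p m \<Longrightarrow> False"
    and st: "s < t" "t \<le> m"
  shows "p s \<noteq> p t \<and> (p s \<rightarrow>\<^bsub>G\<^esub> p t \<longleftrightarrow> t = Suc s)"
proof (intro conjI iffI notI)
  assume eq: "p s = p t"
  \<comment> \<open>Everything after \<open>s\<close> up to and including \<open>t\<close> is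
    skipped, since \<open>p t\<close> equals \<open>p s\<close>.\<close>
  let ?d = "t - s"
  let ?q = "\<lambda>r. if r \<le> s then p r else p (r + ?d)"
  show False
  proof (rule shortest[of "m - ?d" ?q])
    fix r assume r: "r < m - ?d"
    have "p s \<rightarrow>\<^bsub>G\<^esub> p (Suc t)" if "t < m" using walk[OF that] eq by simp
    with r st show "?q r \<rightarrow>\<^bsub>G\<^esub> ?q (Suc r)"
      using walk[of r] walk[of "r + ?d"] by (cases "r = s") auto
  next
    show "?q (m - ?d) = p m"
      using st eq by (cases "t = m") auto
  qed (use st W in auto)
next
  assume adj: "p s \<rightarrow>\<^bsub>G\<^esub> p t"
  show "t = Suc s"
  proof (rule ccontr)
    assume "t \<noteq> Suc s"
    with st have st': "Suc s < t" by simp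
    \<comment> \<open>The chord leads to \<open>p t\<close>, which is now kept, so one vertex fewer
      is skipped.\<close>
    let ?d = "t - Suc s"
    let ?q = "\<lambda>r. if r \<le> s then p r else p (r + ?d)"
    show False
    proof (rule shortest[of "m - ?d" ?q])
      fix r assume r: "r < m - ?d"
      with st' st show "?q r \<rightarrow>\<^bsub>G\<^esub> ?q (Suc r)"
        using walk[of r] walk[of "r + ?d"] adj by (cases "r = s") auto
    next
      show "?q (m - ?d) = p m"
        using st st' by auto
    qed (use st st' W in auto)
  qed
next
  assume "t = Suc s"
  with walk st show "p s \<rightarrow>\<^bsub>G\<^esub> p t" by simp
qed

section \<open>Forbidden induced subgraphs\<close>

locale hole_paraglider_free = graph G for G :: "('a, 'b) pre_digraph" (structure) +
  assumes hole_free: "hole_free G"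
    and paraglider_free: "induced_free paraglider G"
begin

lemma adj_sym: "u \<rightarrow> v \<longleftrightarrow> v \<rightarrow> u"
  using sym_arcs by (auto dest: arcs_ends_symmetric)

lemma adj_irrefl [simp]: "\<not> u \<rightarrow> u"
  using adj_not_same by blast

lemma no_induced_cycle:
  assumes n: "5 \<le> n"
    and dist: "\<And>i j. i < j \<Longrightarrow> j < n \<Longrightarrow> f i \<noteq> f j"
    and adj: "\<And>i j. i < j \<Longrightarrow> j < n \<Longrightarrow> f i \<rightarrow> f j \<longleftrightarrow> j = Suc i \<or> i = 0 \<and> Suc j = n"
  shows False
proof -
  have V: "pverts (cycle_graph n) = {..<n}" by (simp add: cycle_graph_def)
  have E: "(i, j) \<in> parcs (cycle_graph n) \<longleftrightarrow>
      i < n \<and> j < n \<and> (j = Suc i \<or> i = Suc j \<or> i = 0 \<and> Suc j = n \<or> j = 0 \<and> Suc i = n)" for i j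
    using n by (auto simp: cycle_graph_def Let_def mod_Suc)
  have inj: "inj_on f {..<n}"
    by (rule linorder_inj_onI) (use dist in auto)
  have A: "f i \<rightarrow> f j \<longleftrightarrow> (i, j) \<in> parcs (cycle_graph n)" if "i < n" "j < n" for i j
  proof (cases i j rule: linorder_cases)
    case less
    with that show ?thesis using n adj[OF less] by (auto simp: E)
  next
    case equal
    with n that show ?thesis by (auto simp: E)
  next
    case greater
    with that show ?thesis using n adj[OF greater] adj_sym[of "f i"] by (auto simp: E)
  qed
  have img: "f ` {..<n} \<subseteq> verts G"
  proof safe
    fix i assume "i < n"
    \<comment> \<open>Every index has a successor on the cycle, which is 0 for the last one, so
      \<open>f i\<close> is an end of an arc.\<close>
    then obtain j where "(i, j) \<in> parcs (cycle_graph n)" "j < n"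
      using n that[of "Suc i"] that[of 0] by (cases "Suc i = n") (auto simp: E)
    with A \<open>i < n\<close> show "f i \<in> verts G" using adj_in_verts by blast
  qed
  have "digraph_iso (G \<restriction> f ` {..<n}) (with_proj (cycle_graph n))"
    using digraph_iso_induce[of "cycle_graph n" f] pair_graph_cycle_graph[of n] n inj img A
    by (auto simp: V)
  moreover have "induced_subgraph (G \<restriction> f ` {..<n}) G"
    using img by (rule induced_induce)
  ultimately show False using hole_free n by (auto simp: hole_free_def hole_def)
qed

text \<open>Distinctness follows from the adjacencies: identifying two of the vertices would produce
  a loop or turn an edge into a non-edge.\<close>

lemma no_induced_C5:
  assumes "v \<rightarrow> w" "w \<rightarrow> x" "x \<rightarrow> y" "y \<rightarrow> z" "z \<rightarrow> v"
    and "\<not> v \<rightarrow> x" "\<not> v \<rightarrow> y" "\<not> w \<rightarrow> y" "\<not> w \<rightarrow> z" "\<not> x \<rightarrow> z"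
  shows False
proof -
  have d: "v \<noteq> x" "v \<noteq> y" "w \<noteq> y" "w \<noteq> z" "x \<noteq> z" "v \<noteq> w" "w \<noteq> x" "x \<noteq> y" "y \<noteq> z" "v \<noteq> z"
    using assms adj_sym by auto
  have vz: "v \<rightarrow> z" using assms adj_sym by blast
  show False
    by (rule no_induced_cycle[of 5 "(!) [v, w, x, y, z]"])
      (use assms d vz in \<open>auto simp: numeral_eq_Suc less_Suc_eq\<close>)
qed

text \<open>Equivalently: no vertex \<open>t\<close> sees exactly three vertices of an induced 4-cycle.\<close>

lemma no_induced_paraglider:
  assumes "p \<rightarrow> q" "q \<rightarrow> r" "r \<rightarrow> s" "s \<rightarrow> p" "\<not> p \<rightarrow> r" "\<not> q \<rightarrow> s" "p \<noteq> r"
    and "t \<rightarrow> p" "t \<rightarrow> q" "t \<rightarrow> r" "\<not> t \<rightarrow> s"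
  shows False
proof -
  define f where "f = case_paraglider_vertex q t p r s"
  have V: "pverts paraglider = {U1, U2, W1, W2, P}" by (simp add: paraglider_def)
  have f [simp]: "f U1 = q" "f U2 = t" "f W1 = p" "f W2 = r" "f P = s"
    by (simp_all add: f_def)
  \<comment> \<open>Adjacency separates all pairs except \<open>p\<close> and \<open>r\<close>,
    which are twins here and are distinct by hypothesis.\<close>
  have d: "p \<noteq> q" "q \<noteq> r" "r \<noteq> s" "s \<noteq> p" "q \<noteq> s" "t \<noteq> p" "t \<noteq> q" "t \<noteq> r" "t \<noteq> s"
    using assms adj_sym by auto
  have inj: "inj_on f (pverts paraglider)"
    using d \<open>p \<noteq> r\<close> unfolding V by auto
  have img: "f ` pverts paraglider \<subseteq> verts G"
    using assms adj_in_verts unfolding V by auto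
  have adj: "f u \<rightarrow> f v \<longleftrightarrow> (u, v) \<in> parcs paraglider" for u v
    by (cases u; cases v) (use assms adj_sym in \<open>auto simp: paraglider_def Let_def\<close>)
  have "digraph_iso (G \<restriction> f ` pverts paraglider) (with_proj paraglider)"
    using pair_graph_paraglider inj img adj by (rule digraph_iso_induce)
  moreover have "induced_subgraph (G \<restriction> f ` pverts paraglider) G"
    using img by (rule induced_induce)
  ultimately show False using paraglider_free by (auto simp: induced_free_def)
qed

text \<open>The induced path \<open>x 0\<close>, ..., \<open>x m\<close> is closed by a detour
  \<open>ys\<close>, which leaves from \<open>x m\<close> and returns to \<open>x 0\<close>. The
  cycle has \<open>m + 1 + length ys\<close> vertices, at least five by the first bound.\<close>

lemma no_induced_cycle_append:
  assumes n: "4 \<le> m + length ys" and ys: "2 \<le> length ys"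
    and xs: "\<And>i j. i < j \<Longrightarrow> j \<le> m \<Longrightarrow> x i \<noteq> x j \<and> (x i \<rightarrow> x j \<longleftrightarrow> j = Suc i)"
    and ys': "\<And>i j. i < j \<Longrightarrow> j < length ys \<Longrightarrow> ys ! i \<noteq> ys ! j \<and> (ys ! i \<rightarrow> ys ! j \<longleftrightarrow> j = Suc i)"
    and xy: "\<And>i j. i \<le> m \<Longrightarrow> j < length ys \<Longrightarrow>
      x i \<noteq> ys ! j \<and> (x i \<rightarrow> ys ! j \<longleftrightarrow> i = m \<and> j = 0 \<or> i = 0 \<and> Suc j = length ys)"
  shows False
proof -
  define f where "f i = (if i \<le> m then x i else ys ! (i - Suc m))" for i
  have f: "f i \<noteq> f j \<and> (f i \<rightarrow> f j \<longleftrightarrow> j = Suc i \<or> i = 0 \<and> Suc j = m + 1 + length ys)"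
    if ij: "i < j" "j < m + 1 + length ys" for i j
  proof -
    consider "j \<le> m" | "i \<le> m" "m < j" | "m < i" using ij by linarith
    then show ?thesis
    proof cases
      case 1
      with ij xs[of i j] ys show ?thesis by (auto simp: f_def)
    next
      case 2
      with ij xy[of i "j - Suc m"] show ?thesis by (auto simp: f_def)
    next
      case 3
      with ij ys'[of "i - Suc m" "j - Suc m"] show ?thesis by (auto simp: f_def)
    qed
  qed
  show False
    by (rule no_induced_cycle[of "m + 1 + length ys" f]) (use n f in auto)
qed

end

section \<open>Matched pairs of cliques\<close>

text \<open>Two families indexed below \<open>k\<close>, with \<open>a i\<close> matched to
  \<open>b i\<close>, make an enlargement a function update at \<open>k\<close>. The smallest case
  \<open>k = 3\<close> is the complement of the 6-cycle.\<close>

locale matched_cliques = hole_paraglider_free +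
  fixes k :: nat and a b :: "nat \<Rightarrow> 'a"
  assumes three_le: "3 \<le> k"
    and a_adj [simp]: "i < k \<Longrightarrow> j < k \<Longrightarrow> a i \<rightarrow> a j \<longleftrightarrow> i \<noteq> j"
    and b_adj [simp]: "i < k \<Longrightarrow> j < k \<Longrightarrow> b i \<rightarrow> b j \<longleftrightarrow> i \<noteq> j"
    and ab_adj [simp]: "i < k \<Longrightarrow> j < k \<Longrightarrow> a i \<rightarrow> b j \<longleftrightarrow> i = j"
begin

lemma ba_adj [simp]: "i < k \<Longrightarrow> j < k \<Longrightarrow> b i \<rightarrow> a j \<longleftrightarrow> i = j"
  using adj_sym ab_adj by blast

lemma third_index:
  obtains l where "l < k" "l \<noteq> i" "l \<noteq> j"
proof -
  have "0 \<noteq> i \<and> 0 \<noteq> j \<or> 1 \<noteq> i \<and> 1 \<noteq> j \<or> 2 \<noteq> i \<and> 2 \<noteq> j"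
    by linarith
  with three_le that[of 0] that[of 1] that[of 2] show thesis by auto
qed

text \<open>For a third index \<open>l\<close>, the vertex \<open>a l\<close> sees
  \<open>a i\<close> but not \<open>b j\<close>.\<close>

lemma a_neq_b [simp]: "i < k \<Longrightarrow> j < k \<Longrightarrow> a i \<noteq> b j"
  by (metis a_adj ab_adj third_index)

lemma b_neq_a [simp]: "i < k \<Longrightarrow> j < k \<Longrightarrow> b i \<noteq> a j"
  using a_neq_b by metis

lemma a_eq [simp]: "i < k \<Longrightarrow> j < k \<Longrightarrow> a i = a j \<longleftrightarrow> i = j"
  by (metis ab_adj)

lemma b_eq [simp]: "i < k \<Longrightarrow> j < k \<Longrightarrow> b i = b j \<longleftrightarrow> i = j"
  by (metis ab_adj)

definition H :: "'a set" where
  "H = a ` {..<k} \<union> b ` {..<k}"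

text \<open>The set \<open>A_6\<close> of the theorem, taken relative to the enlarged graph; by
  \<open>U_eq\<close> it is the same set.\<close>

definition U :: "'a set" where
  "U = {v \<in> verts G - H. \<forall>h\<in>H. v \<rightarrow> h}"

lemma H_I [intro, simp]: "i < k \<Longrightarrow> a i \<in> H" "i < k \<Longrightarrow> b i \<in> H"
  by (auto simp: H_def)

lemma H_subset: "H \<subseteq> verts G"
proof -
  have "a i \<rightarrow> b i" if "i < k" for i using that by simp
  then show ?thesis using adj_in_verts unfolding H_def by blast
qed

text \<open>One-sided arguments below can thereby be repeated with the two cliques
  exchanged.\<close>

lemma swap: "matched_cliques G k b a"
  by unfold_locales (use three_le in auto)

lemma swap_H: "matched_cliques.H k b a = H"
  using matched_cliques.H_def[OF swap] by (auto simp: H_def)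

lemma nonadjacent_in_H:
  assumes "h \<in> H" "h' \<in> H" "h \<noteq> h'" "\<not> h \<rightarrow> h'"
  obtains i j where "i < k" "j < k" "i \<noteq> j" "h = a i \<and> h' = b j \<or> h = b i \<and> h' = a j"
  using assms unfolding H_def by force

section \<open>Attachment of a single vertex\<close>

text \<open>A vertex that sees three vertices of an induced 4-cycle sees the fourth. Applied to
  \<open>a i, a l, b l, b i\<close> and to \<open>a l, b l, b j, a j\<close>, this shows that
  \<open>x\<close> sees all or none of \<open>b i\<close>, \<open>b l\<close>,
  \<open>a j\<close>.\<close>

lemma third_pair_complete:
  assumes x: "x \<notin> H" and i: "i < k" "x \<rightarrow> a i" and j: "j < k" "x \<rightarrow> b j" and "i \<noteq> j"
    and l: "l < k" "l \<noteq> i" "l \<noteq> j" "x \<rightarrow> a l"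
  shows "x \<rightarrow> b i \<and> x \<rightarrow> a j \<and> x \<rightarrow> b l"
proof -
  have nx: "x \<noteq> a m" "x \<noteq> b m" if "m < k" for m using x that by auto
  note s = adj_sym[of _ x]
  have il: "x \<rightarrow> b i \<longleftrightarrow> x \<rightarrow> b l"
    using no_induced_paraglider[of "a l" "a i" "b i" "b l" x]
      no_induced_paraglider[of "a i" "a l" "b l" "b i" x] i l by auto
  have jl: "x \<rightarrow> a j \<longleftrightarrow> x \<rightarrow> b l"
    using no_induced_paraglider[of "a l" "b l" "b j" "a j" x]
      no_induced_paraglider[of "b j" "a j" "a l" "b l" x] j l by auto
  have "x \<rightarrow> b i"
  proof (rule ccontr)
    assume n: "\<not> x \<rightarrow> b i"
    with il jl have "\<not> x \<rightarrow> a j" by simp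
    \<comment> \<open>Now \<open>x, a i, a j, b j\<close> is an induced 4-cycle of which
      \<open>a l\<close> sees all but \<open>b j\<close>.\<close>
    then show False
      using no_induced_paraglider[of x "a i" "a j" "b j" "a l"] i j l nx \<open>i \<noteq> j\<close> by (auto simp: s)
  qed
  with il jl show ?thesis by simp
qed

text \<open>If \<open>x\<close> missed both \<open>a l\<close> and \<open>b l\<close> for a third
  index \<open>l\<close>, then \<open>x, a i, a l, b l, b j\<close> would be an induced 5-cycle. So
  \<open>third_pair_complete\<close> applies, possibly with the cliques exchanged.\<close>

lemma complete_if_nonclique:
  assumes x: "x \<notin> H" and i: "i < k" "x \<rightarrow> a i" and j: "j < k" "x \<rightarrow> b j" and "i \<noteq> j"
    and h: "h \<in> H"
  shows "x \<rightarrow> h"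
proof -
  interpret swap: matched_cliques G k b a by (rule swap)
  have *: "x \<rightarrow> a i \<and> x \<rightarrow> b i \<and> x \<rightarrow> a j \<and> x \<rightarrow> b j \<and> x \<rightarrow> a l \<and> x \<rightarrow> b l"
    if l: "l < k" "l \<noteq> i" "l \<noteq> j" for l
  proof -
    consider "x \<rightarrow> a l" | "x \<rightarrow> b l"
      using no_induced_C5[of x "a i" "a l" "b l" "b j"] adj_sym[of _ x] i j l \<open>i \<noteq> j\<close> by auto
    then show ?thesis
    proof cases
      case 1
      with third_pair_complete[OF x i j \<open>i \<noteq> j\<close> l] i j show ?thesis by blast
    next
      case 2
      have "x \<notin> swap.H" using x swap_H by simp
      from swap.third_pair_complete[OF this j i \<open>i \<noteq> j\<close>[symmetric] l(1,3,2) 2] 2 i j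
      show ?thesis by blast
    qed
  qed
  obtain l where l: "l < k" "l \<noteq> i" "l \<noteq> j" by (rule third_index)
  \<comment> \<open>One fixed third index settles \<open>i\<close> and \<open>j\<close>; any other
    \<open>m\<close> is itself a third index.\<close>
  have "x \<rightarrow> a m \<and> x \<rightarrow> b m" if "m < k" for m
    using *[OF l] *[OF that] by metis
  with h show ?thesis by (auto simp: H_def)
qed

lemma attachment_clique:
  assumes x: "x \<in> verts G - H - U" and h: "h \<in> H" "h' \<in> H" "x \<rightarrow> h" "x \<rightarrow> h'" "h \<noteq> h'"
  shows "h \<rightarrow> h'"
proof (rule ccontr)
  assume "\<not> h \<rightarrow> h'"
  then obtain i j where "i < k" "j < k" "i \<noteq> j" "h = a i \<and> h' = b j \<or> h = b i \<and> h' = a j"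
    using nonadjacent_in_H h by metis
  then have "\<forall>h\<in>H. x \<rightarrow> h"
    using complete_if_nonclique[of x] x h by blast
  with x show False by (auto simp: U_def)
qed

text \<open>If \<open>x\<close> and \<open>y\<close> were nonadjacent, \<open>x, a 0, y, b 1\<close>
  would be an induced 4-cycle of which \<open>a 2\<close> sees all but \<open>b 1\<close>.\<close>

lemma U_clique: "clique G U"
  unfolding clique_def
proof (intro conjI ballI impI)
  show "U \<subseteq> verts G" by (auto simp: U_def)
next
  fix x y assume x: "x \<in> U" and y: "y \<in> U" and "x \<noteq> y"
  show "x \<rightarrow> y"
  proof (rule ccontr)
    assume "\<not> x \<rightarrow> y"
    moreover have "x \<rightarrow> h \<and> h \<rightarrow> x \<and> y \<rightarrow> h \<and> h \<rightarrow> y" if "h \<in> H" for h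
      using x y that adj_sym by (auto simp: U_def)
    ultimately show False
      using no_induced_paraglider[of x "a 0" y "b 1" "a 2"] three_le \<open>x \<noteq> y\<close> by auto
  qed
qed

text \<open>Two matched pairs already contain the nonadjacent vertices \<open>a i\<close> and
  \<open>b j\<close>, so \<open>complete_if_nonclique\<close> applies. This identifies
  \<open>A_6\<close>, which is defined from the original six vertices, with
  \<open>U\<close>.\<close>

lemma U_eq:
  assumes A: "A \<subseteq> H" and ij: "i < k" "j < k" "i \<noteq> j" and ab: "{a i, a j, b i, b j} \<subseteq> A"
  shows "U = {v \<in> verts G - A. \<forall>h\<in>A. v \<rightarrow> h}"
proof (intro equalityI subsetI)
  fix v assume "v \<in> U"
  with A show "v \<in> {v \<in> verts G - A. \<forall>h\<in>A. v \<rightarrow> h}" by (auto simp: U_def)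
next
  fix v assume "v \<in> {v \<in> verts G - A. \<forall>h\<in>A. v \<rightarrow> h}"
  then have v: "v \<in> verts G" "v \<rightarrow> a i" "v \<rightarrow> a j" "v \<rightarrow> b i" "v \<rightarrow> b j" using ab by auto
  \<comment> \<open>A vertex of \<open>H\<close> sees only one vertex of the opposite clique,
    whereas \<open>v\<close> sees two in each.\<close>
  have "v \<notin> H"
    using v ij unfolding H_def by auto
  then have "\<forall>h\<in>H. v \<rightarrow> h"
    using complete_if_nonclique[of v i j] v ij by blast
  with \<open>v \<notin> H\<close> v show "v \<in> U" by (auto simp: U_def)
qed

section \<open>Shortest walks with nonadjacent attachments\<close>

text \<open>The hypothesis \<open>clique\<close> leaves the two ends of the walk as the only place
  for a pair of nonadjacent attachments. A detour through \<open>H\<close> would close the walk to a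
  hole unless some walk vertex has a further neighbour on it; trying several detours pins down all
  attachments.\<close>

lemma shortest_attached_walk:
  assumes W: "\<And>t. t \<le> m \<Longrightarrow> p t \<in> verts G - H - U"
    and induced: "\<And>s t. s < t \<Longrightarrow> t \<le> m \<Longrightarrow> p s \<noteq> p t \<and> (p s \<rightarrow> p t \<longleftrightarrow> t = Suc s)"
    and clique: "\<And>s t h h'. s \<le> t \<Longrightarrow> t \<le> m \<Longrightarrow> s \<noteq> 0 \<or> t \<noteq> m \<Longrightarrow> h \<in> H \<Longrightarrow> h' \<in> H \<Longrightarrow>
      p s \<rightarrow> h \<Longrightarrow> p t \<rightarrow> h' \<Longrightarrow> h \<noteq> h' \<Longrightarrow> h \<rightarrow> h'"
    and i: "i < k" "p 0 \<rightarrow> a i" and j: "j < k" "p m \<rightarrow> b j" and "i \<noteq> j"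
  shows "m = 1 \<and> (\<forall>l<k. p 0 \<rightarrow> a l \<and> \<not> p 0 \<rightarrow> b l \<and> p 1 \<rightarrow> b l \<and> \<not> p 1 \<rightarrow> a l)"
proof -
  have m: "0 < m"
    using attachment_clique[of "p 0" "a i" "b j"] W[of 0] i j \<open>i \<noteq> j\<close> by (cases "m = 0") auto
  have ends: "s = 0 \<and> t = m \<or> s = m \<and> t = 0"
    if "s \<le> m" "t \<le> m" "l < k" "l' < k" "l \<noteq> l'" "p s \<rightarrow> a l" "p t \<rightarrow> b l'" for s t l l'
  proof (rule ccontr)
    assume n: "\<not> (s = 0 \<and> t = m \<or> s = m \<and> t = 0)"
    have "\<not> a l \<rightarrow> b l'" "\<not> b l' \<rightarrow> a l" "a l \<noteq> b l'" "a l \<in> H" "b l' \<in> H"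
      using that by simp_all
    with n that clique[of s t "a l" "b l'"] clique[of t s "b l'" "a l"]
    show False by (metis nat_le_linear)
  qed
  have nH: "p t \<noteq> a l" "p t \<noteq> b l" if "t \<le> m" "l < k" for t l
    using W[OF that(1)] that(2) by auto
  have ai: "p t \<rightarrow> a i \<longleftrightarrow> t = 0" if "t \<le> m" for t
    using ends[of t m i j] that i j \<open>i \<noteq> j\<close> m by auto
  have bj: "p t \<rightarrow> b j \<longleftrightarrow> t = m" if "t \<le> m" for t
    using ends[of 0 t i j] that i j \<open>i \<noteq> j\<close> m by auto
  \<comment> \<open>Otherwise the detour \<open>b j, a j, a i\<close> closes a hole, long enough
    because \<open>0 < m\<close>.\<close>
  have "\<exists>t\<le>m. p t \<rightarrow> a j"
  proof (rule ccontr)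
    assume n: "\<not> (\<exists>t\<le>m. p t \<rightarrow> a j)"
    show False
      by (rule no_induced_cycle_append[of m "[b j, a j, a i]" p])
        (use m induced ai bj n nH i j \<open>i \<noteq> j\<close> in \<open>auto simp: less_Suc_eq numeral_eq_Suc\<close>)
  qed
  then obtain t where t: "t \<le> m" "p t \<rightarrow> a j" by blast
  have "\<exists>s\<le>m. p s \<rightarrow> b i"
  proof (rule ccontr)
    assume n: "\<not> (\<exists>t\<le>m. p t \<rightarrow> b i)"
    show False
      by (rule no_induced_cycle_append[of m "[b j, b i, a i]" p])
        (use m induced ai bj n nH i j \<open>i \<noteq> j\<close> in \<open>auto simp: less_Suc_eq numeral_eq_Suc\<close>)
  qed
  then obtain s where s: "s \<le> m" "p s \<rightarrow> b i" by blast
  \<comment> \<open>Here the detour is \<open>b j, b l, a l, a i\<close>.\<close>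
  have ex: "\<exists>r\<le>m. p r \<rightarrow> a l \<or> p r \<rightarrow> b l" if l: "l < k" "l \<noteq> i" "l \<noteq> j" for l
  proof (rule ccontr)
    assume n: "\<not> (\<exists>r\<le>m. p r \<rightarrow> a l \<or> p r \<rightarrow> b l)"
    show False
      by (rule no_induced_cycle_append[of m "[b j, b l, a l, a i]" p])
        (use m induced ai bj n nH i j l \<open>i \<noteq> j\<close> in \<open>auto simp: less_Suc_eq numeral_eq_Suc\<close>)
  qed
  obtain l where l: "l < k" "l \<noteq> i" "l \<noteq> j" by (rule third_index)
  with ex obtain r where r: "r \<le> m" "p r \<rightarrow> a l \<or> p r \<rightarrow> b l" by meson
  \<comment> \<open>In the other order \<open>p 0\<close> sees \<open>a i, b i\<close> and
    \<open>p m\<close> sees \<open>a j, b j\<close>. A walk vertex that sees \<open>a l\<close> or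
    \<open>b l\<close> would then have to be both ends at once.\<close>
  have st: "t = 0 \<and> s = m"
  proof (rule ccontr)
    assume "\<not> (t = 0 \<and> s = m)"
    with ends[of t s j i] s t i j \<open>i \<noteq> j\<close> have ts: "t = m" "s = 0" by auto
    from r(2) show False
    proof
      assume "p r \<rightarrow> a l"
      with ends[of r s l i] ends[of r m l j] r s j i l m ts show False by auto
    next
      assume "p r \<rightarrow> b l"
      with ends[of t r j l] ends[of 0 r i l] r t j i l m ts show False by auto
    qed
  qed
  have aj: "p r \<rightarrow> a j \<longleftrightarrow> r = 0" if "r \<le> m" for r
    using ends[of r m j i] that s t st i j \<open>i \<noteq> j\<close> m by auto
  have bi: "p r \<rightarrow> b i \<longleftrightarrow> r = m" if "r \<le> m" for r
    using ends[of 0 r j i] that s t st i j \<open>i \<noteq> j\<close> m by auto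
  \<comment> \<open>Only \<open>p 0\<close> sees \<open>a i\<close> and only \<open>p m\<close> sees
    \<open>b i\<close>, so the detour \<open>b i, a i\<close> gives an induced cycle on
    \<open>m + 3\<close> vertices, a hole as soon as 2 \<le> \<open>m\<close>.\<close>
  have "m = 1"
  proof (rule ccontr)
    assume "m \<noteq> 1"
    show False
      by (rule no_induced_cycle_append[of m "[b i, a i]" p])
        (use m \<open>m \<noteq> 1\<close> induced ai bi nH i in \<open>auto simp: less_Suc_eq numeral_eq_Suc\<close>)
  qed
  \<comment> \<open>\<open>p 1\<close> sees both \<open>b i\<close> and \<open>b j\<close>, and at
    least one of them is not adjacent to \<open>a l\<close>.\<close>
  have a0: "\<not> p 1 \<rightarrow> a l" if "l < k" for l
    using ends[of 1 1 l i] ends[of 1 1 l j] that i j \<open>i \<noteq> j\<close> \<open>m = 1\<close> bi bj by auto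
  have b0: "\<not> p 0 \<rightarrow> b l" if "l < k" for l
    using ends[of 0 0 i l] ends[of 0 0 j l] that i j \<open>i \<noteq> j\<close> \<open>m = 1\<close> ai aj by auto
  have p01: "p 0 \<rightarrow> p 1" using induced[of 0 1] \<open>m = 1\<close> by simp
  have p1: "p 1 \<rightarrow> b i" "p 1 \<rightarrow> b j" using bi[of 1] bj[of 1] \<open>m = 1\<close> by simp_all
  have p0: "p 0 \<rightarrow> a i" "p 0 \<rightarrow> a j" using ai[of 0] aj[of 0] by simp_all
  \<comment> \<open>For a third index at least one of the two edges is present, and each forces the
    other by a 5-cycle through the edge from \<open>p 0\<close> to \<open>p 1\<close>.\<close>
  have "p 0 \<rightarrow> a l \<and> p 1 \<rightarrow> b l" if l: "l < k" for l
  proof (cases "l = i \<or> l = j")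
    case True
    with p0 p1 show ?thesis by auto
  next
    case False
    then have l': "l \<noteq> i" "l \<noteq> j" by auto
    obtain r where r: "r \<le> m" "p r \<rightarrow> a l \<or> p r \<rightarrow> b l"
      using ex[OF l l'] by blast
    from r(1) \<open>m = 1\<close> have "r = 0 \<or> r = 1" by auto
    with r(2) have "p 0 \<rightarrow> a l \<or> p 1 \<rightarrow> b l" using a0[OF l] b0[OF l] by blast
    moreover have "p 1 \<rightarrow> b l" if al: "p 0 \<rightarrow> a l"
    proof (rule ccontr)
      assume "\<not> p 1 \<rightarrow> b l"
      moreover have "a l \<rightarrow> p 0" using al adj_sym by blast
      ultimately show False
        using l l' i by (intro no_induced_C5[of "p 0" "p 1" "b i" "b l" "a l"])
          (simp_all add: p01 p1 a0 b0 del: One_nat_def)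
    qed
    moreover have "p 0 \<rightarrow> a l" if bl: "p 1 \<rightarrow> b l"
    proof (rule ccontr)
      assume n: "\<not> p 0 \<rightarrow> a l"
      have "a i \<rightarrow> p 0" using p0 adj_sym by blast
      with n show False
        using l l' i bl by (intro no_induced_C5[of "p 0" "p 1" "b l" "a l" "a i"])
          (simp_all add: p01 a0 b0 p0 del: One_nat_def)
    qed
    ultimately show ?thesis by blast
  qed
  with \<open>m = 1\<close> a0 b0 show ?thesis by blast
qed

lemma extend:
  assumes adj: "u \<rightarrow> v"
    and uv: "\<And>l. l < k \<Longrightarrow> u \<rightarrow> a l \<and> \<not> u \<rightarrow> b l \<and> v \<rightarrow> b l \<and> \<not> v \<rightarrow> a l"
  shows "matched_cliques G (Suc k) (a(k := u)) (b(k := v))"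
proof -
  have vu: "a l \<rightarrow> u \<and> \<not> b l \<rightarrow> u \<and> b l \<rightarrow> v \<and> \<not> a l \<rightarrow> v" if "l < k" for l
    using uv[OF that] adj_sym by blast
  show ?thesis
    by unfold_locales (use three_le adj uv vu in \<open>auto simp: less_Suc_eq\<close>)
qed

text \<open>Contrapositively, the attachments of a component to a maximal \<open>H\<close> form a
  clique.\<close>

lemma extension_if_nonclique_attachment:
  assumes reach: "x \<rightarrow>\<^sup>*\<^bsub>G \<restriction> (verts G - H - U)\<^esub> y"
    and h: "h \<in> H" "h' \<in> H" "x \<rightarrow> h" "y \<rightarrow> h'" "h \<noteq> h'" "\<not> h \<rightarrow> h'"
  obtains u v where "matched_cliques G (Suc k) (a(k := u)) (b(k := v))"
proof -
  define W where "W = verts G - H - U"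
  \<comment> \<open>The ends of the walk and their attachments are not fixed. A shortest bad walk is
    therefore not only induced: any two attachments not coming from its two ends are adjacent or
    equal, as a proper subwalk would be bad otherwise.\<close>
  define bad where "bad p m \<longleftrightarrow> (\<forall>t\<le>m. p t \<in> W) \<and> (\<forall>t<m. p t \<rightarrow> p (Suc t)) \<and>
    (\<exists>h\<in>H. \<exists>h'\<in>H. p 0 \<rightarrow> h \<and> p m \<rightarrow> h' \<and> h \<noteq> h' \<and> \<not> h \<rightarrow> h')" for p :: "nat \<Rightarrow> 'a" and m
  obtain q n where "q 0 = x" "q n = y" "\<And>t. t \<le> n \<Longrightarrow> q t \<in> W" "\<And>t. t < n \<Longrightarrow> q t \<rightarrow> q (Suc t)"
    using reachable_induce_walk[OF reach[folded W_def]] by blast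
  with h have "bad q n" unfolding bad_def by blast
  then have ex: "\<exists>n q. bad q n" by blast
  define m where "m = (LEAST n. \<exists>q. bad q n)"
  have least: "\<not> bad q n" if "n < m" for q n
    using not_less_Least[OF that[unfolded m_def]] by blast
  obtain p where p: "bad p m"
    using LeastI_ex[OF ex] unfolding m_def by blast
  then have W: "\<And>t. t \<le> m \<Longrightarrow> p t \<in> W" and walk: "\<And>t. t < m \<Longrightarrow> p t \<rightarrow> p (Suc t)"
    by (auto simp: bad_def)
  from p obtain g g' where g: "g \<in> H" "g' \<in> H" "p 0 \<rightarrow> g" "p m \<rightarrow> g'" "g \<noteq> g'" "\<not> g \<rightarrow> g'"
    unfolding bad_def by blast
  have induced: "p s \<noteq> p t \<and> (p s \<rightarrow> p t \<longleftrightarrow> t = Suc s)" if "s < t" "t \<le> m" for s t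
  proof (rule shortest_walk_induced[where W = W and m = m])
    fix q n assume "n < m" "\<And>t. t \<le> n \<Longrightarrow> q t \<in> W" "\<And>t. t < n \<Longrightarrow> q t \<rightarrow> q (Suc t)"
      "q 0 = p 0" "q n = p m"
    with g have "bad q n" unfolding bad_def by metis
    with least \<open>n < m\<close> show False by blast
  qed (use W walk that in auto)
  have clique: "h \<rightarrow> h'" if st: "s \<le> t" "t \<le> m" "s \<noteq> 0 \<or> t \<noteq> m"
    and h: "h \<in> H" "h' \<in> H" "p s \<rightarrow> h" "p t \<rightarrow> h'" "h \<noteq> h'" for s t h h'
  proof (rule ccontr)
    assume n: "\<not> h \<rightarrow> h'"
    \<comment> \<open>The stretch from \<open>s\<close> to \<open>t\<close>, reindexed to start at
      0, would be a shorter bad walk.\<close>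
    have "p (s + r) \<in> W" if "r \<le> t - s" for r using W that st by simp
    moreover have "p (s + r) \<rightarrow> p (s + Suc r)" if "r < t - s" for r
      using walk[of "s + r"] that st by simp
    moreover have "p (s + 0) \<rightarrow> h" "p (s + (t - s)) \<rightarrow> h'" using h st by simp_all
    ultimately have "bad (\<lambda>r. p (s + r)) (t - s)"
      unfolding bad_def using h n by blast
    moreover have "t - s < m" using st by auto
    ultimately show False using least by blast
  qed
  interpret swap: matched_cliques G k b a by (rule swap)
  have HU: "swap.H = H" "swap.U = U"
    using swap_H unfolding swap.U_def U_def by simp_all
  obtain i j where ij: "i < k" "j < k" "i \<noteq> j" "g = a i \<and> g' = b j \<or> g = b i \<and> g' = a j"
    using nonadjacent_in_H[OF g(1,2,5,6)] by blast
  from ij(4) show thesis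
  proof
    assume "g = a i \<and> g' = b j"
    with g have "p 0 \<rightarrow> a i" "p m \<rightarrow> b j" by simp_all
    note * = shortest_attached_walk[of m p i j, OF _ _ _ ij(1) this(1) ij(2) this(2) ij(3)]
    have "m = 1 \<and> (\<forall>l<k. p 0 \<rightarrow> a l \<and> \<not> p 0 \<rightarrow> b l \<and> p 1 \<rightarrow> b l \<and> \<not> p 1 \<rightarrow> a l)"
      by (rule *) (assumption | rule W[unfolded W_def] induced clique)+
    with walk[of 0] show thesis
      by (intro that[of "p 0" "p 1"] extend) auto
  next
    \<comment> \<open>The walk starts at the \<open>b\<close> side, so the cliques are exchanged and
      the new pair is \<open>p 1\<close>, \<open>p 0\<close> in this order.\<close>
    assume "g = b i \<and> g' = a j"
    with g have "p 0 \<rightarrow> b i" "p m \<rightarrow> a j" by simp_all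
    note * = swap.shortest_attached_walk[of m p i j, unfolded HU,
        OF _ _ _ ij(1) this(1) ij(2) this(2) ij(3)]
    have "m = 1 \<and> (\<forall>l<k. p 0 \<rightarrow> b l \<and> \<not> p 0 \<rightarrow> a l \<and> p 1 \<rightarrow> a l \<and> \<not> p 1 \<rightarrow> b l)"
      by (rule *) (assumption | rule W[unfolded W_def] induced clique)+
    moreover from this walk[of 0] have "p 1 \<rightarrow> p 0" using adj_sym by simp
    ultimately show thesis
      by (intro that[of "p 1" "p 0"] extend) auto
  qed
qed

section \<open>The clique separator\<close>

lemma verts_eq_H_Un_U:
  assumes con: "connected G" and atom: "\<not> (\<exists>K. clique_separator G K)"
    and maximal: "\<And>u v. \<not> matched_cliques G (Suc k) (a(k := u)) (b(k := v))"
  shows "verts G = H \<union> U"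
proof (rule ccontr)
  assume "verts G \<noteq> H \<union> U"
  moreover have "H \<union> U \<subseteq> verts G" using H_subset by (auto simp: U_def)
  ultimately obtain x where x: "x \<in> verts G - H - U" by blast
  define W where "W = verts G - H - U"
  interpret W: wf_digraph "G \<restriction> W" by (rule wellformed_induce_subgraph)
  have symW: "symmetric (G \<restriction> W)"
    using sym_arcs by (auto simp: symmetric_def sym_def dominates_induce_iff)
  \<comment> \<open>\<open>C\<close> is the component of \<open>x\<close> among the vertices outside
    \<open>H\<close> and \<open>U\<close>, and \<open>Q\<close> collects its attachments.\<close>
  define C where "C = {y. x \<rightarrow>\<^sup>*\<^bsub>G \<restriction> W\<^esub> y}"
  define Q where "Q = {h \<in> H. \<exists>y\<in>C. y \<rightarrow> h}"
  have x': "x \<in> C" using x W.reachable_refl[of x] by (simp add: C_def W_def)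
  have CW: "C \<subseteq> W" using W.reachable_in_verts(2) by (auto simp: C_def)
  have Q_adj: "h \<rightarrow> h'" if h: "h \<in> Q" "h' \<in> Q" "h \<noteq> h'" for h h'
  proof (rule ccontr)
    assume n: "\<not> h \<rightarrow> h'"
    obtain y y' where y: "y \<in> C" "y \<rightarrow> h" "y' \<in> C" "y' \<rightarrow> h'"
      using h by (auto simp: Q_def)
    then have "y \<rightarrow>\<^sup>*\<^bsub>G \<restriction> W\<^esub> x" "x \<rightarrow>\<^sup>*\<^bsub>G \<restriction> W\<^esub> y'"
      using symmetric_reachable[OF symW] by (simp_all add: C_def)
    then have "y \<rightarrow>\<^sup>*\<^bsub>G \<restriction> W\<^esub> y'" by (rule W.reachable_trans)
    from extension_if_nonclique_attachment[OF this[unfolded W_def], of h h'] y n h maximal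
    show False by (auto simp: Q_def)
  qed
  have HU: "h \<rightarrow> u \<and> u \<rightarrow> h" if "h \<in> H" "u \<in> U" for h u
    using that adj_sym by (auto simp: U_def)
  have QH: "Q \<subseteq> H" by (auto simp: Q_def)
  have UK: "u \<rightarrow> v" if "u \<in> U" "v \<in> U" "u \<noteq> v" for u v
    using U_clique that by (auto simp: clique_def)
  have K: "clique G (Q \<union> U)"
    using Q_adj UK HU QH H_subset U_clique unfolding clique_def by blast
  \<comment> \<open>The separator has to leave a vertex of \<open>H\<close>: the clique
    \<open>Q\<close> misses one of two nonadjacent vertices.\<close>
  have "\<not> (a 0 \<in> Q \<and> b 1 \<in> Q)"
    using Q_adj[of "a 0" "b 1"] three_le by auto
  moreover have "a 0 \<in> H" "b 1 \<in> H" using three_le by simp_all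
  ultimately obtain h where h: "h \<in> H" "h \<notin> Q" by blast
  let ?G = "G \<restriction> (verts G - (Q \<union> U))"
  interpret K: wf_digraph ?G by (rule wellformed_induce_subgraph)
  \<comment> \<open>A neighbour of \<open>C\<close> in \<open>H\<close> lies in \<open>Q\<close>, so
    a walk avoiding \<open>Q\<close> and \<open>U\<close> stays in \<open>W\<close> and hence in
    \<open>C\<close>.\<close>
  have "y \<in> C" if "x \<rightarrow>\<^sup>*\<^bsub>?G\<^esub> y" for y
    using that
  proof (induction rule: K.reachable_induct)
    case base
    show ?case by (rule x')
  next
    case (step y z)
    then have z: "z \<in> verts G" "z \<notin> Q" "z \<notin> U" "y \<rightarrow> z" by (auto simp: dominates_induce_iff)
    with step.IH have "z \<in> W" by (auto simp: Q_def W_def)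
    with z step.IH CW have "y \<rightarrow>\<^bsub>G \<restriction> W\<^esub> z" by (auto simp: dominates_induce_iff)
    with step.IH show ?case using W.reachable_adj_trans[of x y z] by (simp add: C_def)
  qed
  then have "\<not> x \<rightarrow>\<^sup>*\<^bsub>?G\<^esub> h"
    using CW h by (auto simp: W_def)
  moreover have "x \<in> verts G - (Q \<union> U)" using x QH by blast
  moreover have "h \<in> verts G - (Q \<union> U)" using h H_subset by (auto simp: U_def)
  ultimately have "clique_separator G (Q \<union> U)"
    using con K by (intro clique_separatorI)
  with atom show False by blast
qed

lemma matched_co_bipartite_induce_H: "matched_co_bipartite (G \<restriction> H)"
  unfolding matched_co_bipartite_def
proof (rule exI[of _ "a ` {..<k}"], rule exI[of _ "b ` {..<k}"], intro conjI)
  show "a ` {..<k} \<union> b ` {..<k} = verts (G \<restriction> H)" by (simp add: H_def)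
  show "a ` {..<k} \<inter> b ` {..<k} = {}" by auto
  show "clique (G \<restriction> H) (a ` {..<k})" "clique (G \<restriction> H) (b ` {..<k})"
    by (auto simp: clique_def dominates_induce_iff)
  show "card (a ` {..<k}) = card (b ` {..<k})"
    by (simp add: card_image inj_on_def)
  show "\<forall>u\<in>a ` {..<k}. \<exists>!v. v \<in> b ` {..<k} \<and> u \<rightarrow>\<^bsub>G \<restriction> H\<^esub> v"
    by (auto simp: dominates_induce_iff)
  show "\<forall>v\<in>b ` {..<k}. \<exists>!u. u \<in> a ` {..<k} \<and> u \<rightarrow>\<^bsub>G \<restriction> H\<^esub> v"
    by (auto simp: dominates_induce_iff)
qed

text \<open>Bounds the enlargements, so that a largest one exists.\<close>

lemma k_le_card: "k \<le> card (verts G)"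
proof -
  have "card (a ` {..<k}) = k" by (simp add: card_image inj_on_def)
  moreover have "a ` {..<k} \<subseteq> verts G" using H_subset by (auto simp: H_def)
  ultimately show ?thesis by (metis card_mono finite_verts)
qed

end

section \<open>Starting from the complement of the 6-cycle\<close>

lemma dominates_induced_subgraph_iff:
  assumes "induced_subgraph A G" "u \<in> verts A" "v \<in> verts A"
  shows "u \<rightarrow>\<^bsub>A\<^esub> v \<longleftrightarrow> u \<rightarrow>\<^bsub>G\<^esub> v"
  using assms by (auto simp: induced_subgraph_def subgraph_def compatible_def arcs_ends_conv)

theorem theorem2:
  fixes G A :: "('a, 'b) pre_digraph"
  assumes "graph G" and "connected G"
    and "hole_free G"
    and "induced_free paraglider G"
    and "\<not> (\<exists>K. clique_separator G K)"
    and "induced_subgraph A G" and "digraph_iso A co_C6"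
  shows "matched_co_bipartite
    (G \<restriction> (verts G - {v \<in> verts G - verts A. \<forall>a\<in>verts A. v \<rightarrow>\<^bsub>G\<^esub> a}))"
proof -
  interpret graph G by (rule assms(1))
  interpret hole_paraglider_free G
    by unfold_locales (rule assms(3), rule assms(4))
  obtain f where f: "bij_betw f (pverts co_C6) (verts A)"
    and adjA: "\<And>u v. u \<in> pverts co_C6 \<Longrightarrow> v \<in> pverts co_C6 \<Longrightarrow> f u \<rightarrow>\<^bsub>A\<^esub> f v \<longleftrightarrow> (u, v) \<in> parcs co_C6"
    using digraph_iso_verts_map[OF assms(7)] by blast
  have V: "pverts co_C6 = {0, 1, 2, 3, 4, 5}"
    by (auto simp: co_C6_def complement_graph_def cycle_graph_def)
  have adj: "f u \<rightarrow>\<^bsub>G\<^esub> f v \<longleftrightarrow> u \<noteq> v \<and> \<not> (v = (u + 1) mod 6 \<or> u = (v + 1) mod 6)"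
    if "u \<in> {0, 1, 2, 3, 4, 5}" "v \<in> {0, 1, 2, 3, 4, 5}" for u v
  proof -
    have "f u \<rightarrow>\<^bsub>G\<^esub> f v \<longleftrightarrow> (u, v) \<in> parcs co_C6"
      using that adjA[of u v] dominates_induced_subgraph_iff[OF assms(6), of "f u" "f v"] f
      by (auto simp: V bij_betw_def)
    with that show ?thesis
      by (auto simp: co_C6_def complement_graph_def cycle_graph_def Let_def)
  qed
  \<comment> \<open>The even and the odd vertices of the 6-cycle form the two triangles of its
    complement, and each vertex is matched with the opposite one, at distance 3 on the
    cycle.\<close>
  let ?a = "(!) [f 0, f 2, f 4]" and ?b = "(!) [f 3, f 5, f 1]"
  have less3: "i < 3 \<longleftrightarrow> i = 0 \<or> i = 1 \<or> i = 2" for i :: nat by auto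
  have init: "matched_cliques G 3 ?a ?b"
    by unfold_locales (auto simp: less3 adj)
  \<comment> \<open>Only enlargements that keep the first three pairs compete, so that the final
    \<open>H\<close> still contains \<open>A\<close>.\<close>
  define P where "P k \<longleftrightarrow> (\<exists>a b. matched_cliques G k a b \<and>
    (\<forall>i<3. a i = ?a i \<and> b i = ?b i))" for k
  have "P 3" using init by (auto simp: P_def)
  moreover have "\<And>k. P k \<Longrightarrow> k \<le> card (verts G)"
    using matched_cliques.k_le_card by (auto simp: P_def)
  ultimately obtain k where k: "P k" "\<And>k'. P k' \<Longrightarrow> k' \<le> k"
    using Nat.ex_has_greatest_nat[of P 3 "card (verts G)"] by blast
  then obtain a b where mc: "matched_cliques G k a b" and ab: "\<forall>i<3. a i = ?a i \<and> b i = ?b i"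
    by (auto simp: P_def)
  interpret matched_cliques G k a b by (rule mc)
  have "\<not> matched_cliques G (Suc k) (a(k := u)) (b(k := v))" for u v
  proof
    assume "matched_cliques G (Suc k) (a(k := u)) (b(k := v))"
    moreover have "\<forall>i<3. (a(k := u)) i = ?a i \<and> (b(k := v)) i = ?b i"
      using ab three_le by simp
    ultimately have "P (Suc k)" unfolding P_def by blast
    with k(2) show False by force
  qed
  then have verts: "verts G = H \<union> U"
    by (intro verts_eq_H_Un_U assms(2,5))
  have "verts A = {a 0, a 1, a 2, b 0, b 1, b 2}"
    using f ab by (auto simp: V bij_betw_def)
  \<comment> \<open>\<open>A\<close> contains the matched pairs with indices 0 and 1, so being
    complete to \<open>A\<close> amounts to being complete to \<open>H\<close>.\<close>
  then have "U = {v \<in> verts G - verts A. \<forall>a\<in>verts A. v \<rightarrow>\<^bsub>G\<^esub> a}"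
    using three_le by (intro U_eq[of _ 0 1]) auto
  moreover have "verts G - U = H"
    using verts by (auto simp: U_def)
  ultimately show ?thesis
    using matched_co_bipartite_induce_H by simp
qed

end
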